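(* Let $\mathbf f:[0,T]\to\mathbb R^{n_1\times\cdots\times n_d}$ be the exact solution of $\frac{d\mathbf f}{dt}=\mathbf N(\mathbf f)$, $\mathbf f(0)=\mathbf f_0$, with $\mathbf N$ Lipschitz, and let $\Delta t=T/N$. Consider the rank-adaptive Euler method $$\mathbf f_{k+1}=\mathfrak T_{\mathbf r_k}\left(\mathbf f_k+\Delta t\,\mathfrak T_{\mathbf s_k}(\mathbf N(\mathbf f_k))\right),\qquad k=0,1,\dots,N-1.$$ Suppose there are constants $M_1,M_2$, independent of $k$ and $\Delta t$, such that the truncation ranks $\mathbf s_k,\mathbf r_k$ satisfy $$\left\|\mathbf N(\mathbf f_k)-\mathfrak T_{\mathbf s_k}(\mathbf N(\mathbf f_k))\right\|_2\le M_1\Delta t,$$ $$\left\|\mathbf f_k+\Delta t\,\mathfrak T_{\mathbf s_k}(\mathbf N(\mathbf f_k))-\mathfrak T_{\mathbf r_k}\left(\mathbf f_k+\Delta t\,\mathfrak T_{\mathbf s_k}(\mathbf N(\mathbf f_k))\right)\right\|_2\le M_2\Delta t^2$$ for all $k$. Then the method has $O(\Delta t)$ global error: $\|\mathbf f(T)-\mathbf f_N\|_2\le Q\Delta t$ for all sufficiently small $\Delta t$, with $Q$ independent of $\Delta t$.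
   Context: Throughout, $d\ge2$, $\|\cdot\|_2$ is the Euclidean (Frobenius) norm, $\mathbf N$ is a map from $\mathbb R^{n_1\times\cdots\times n_d}$ to itself, and $N$ (not bold) is the number of time steps. Hierarchical Tucker format: fix a dimension tree $\mathcal T_d$ (binary tree with root $\{1,\dots,d\}$, leaves the singletons, every non-leaf node the disjoint union of its two children). For $\alpha\in\mathcal T_d$, $\mathbf f^{(\alpha)}$ is the matricization of $\mathbf f$ with rows indexed by the modes in $\alpha$ and columns by the others. For $\mathbf r=\{r_\alpha\}$, $\mathcal H_{\mathbf r}=\{\mathbf f:\operatorname{rank}\mathbf f^{(\alpha)}=r_\alpha\ \forall\alpha\}$, with closure $\overline{\mathcal H}_{\mathbf r}=\{\mathbf f:\operatorname{rank}\mathbf f^{(\alpha)}\le r_\alpha\ \forall\alpha\}$. $\mathfrak T_{\mathbf r}$ denotes any optimal or quasi-optimal truncation operator onto $\overline{\mathcal H}_{\mathbf r}$, e.g. $\mathfrak T^{\rm best}_{\mathbf r}(\mathbf f)\in\operatorname{argmin}_{\mathbf h\in\overline{\mathcal H}_{\mathbf r}}\|\mathbf f-\mathbf h\|_2$, or the high-order SVD truncation, which satisfies $\|\mathbf f-\mathfrak T_{\mathbf r}(\mathbf f)\|_2\le\sqrt{2d-3}\,\|\mathbf f-\mathfrak T^{\rm best}_{\mathbf r}(\mathbf f)\|_2$. The ranks $\mathbf r_k,\mathbf s_k$ may change from step to step. *)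

theory Defs
  imports "HOL-Analysis.Analysis" "Jordan_Normal_Form.DL_Rank"
begin

no_notation vec_index (infixl \<open>$\<close> 100)

definition multi_indices :: "nat \<Rightarrow> (nat \<Rightarrow> nat) \<Rightarrow> (nat \<Rightarrow> nat) set" where
  "multi_indices d n = (\<Pi>\<^sub>E k\<in>{1..d}. {1..n k})"

text \<open>
  The space of tensors with mode sizes \<open>n 1, ..., n d\<close> is rendered as the Euclidean space
  \<open>real ^ 'i\<close>, where a bijection \<open>pos\<close> from \<open>multi_indices d n\<close> onto the finite type \<open>'i\<close>
  identifies \<open>'i\<close> with the set of multi-indices: the entry of \<open>f\<close> at \<open>(\<mu> 1, ..., \<mu> d)\<close> is
  \<open>f $ pos \<mu>\<close>. The library norm on \<open>real ^ 'i\<close> is then the Frobenius norm. Such a bijection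
  exists only if all mode sizes are positive.
\<close>
definition tensor_indexing :: "nat \<Rightarrow> (nat \<Rightarrow> nat) \<Rightarrow> ((nat \<Rightarrow> nat) \<Rightarrow> 'i::finite) \<Rightarrow> bool" where
  "tensor_indexing d n pos \<longleftrightarrow> bij_betw pos (multi_indices d n) (UNIV :: 'i set)"

text \<open>\<open>dimension_tree \<rho> S\<close>: \<open>S\<close> is the set of all nodes of a dimension tree with root \<open>\<rho>\<close>.\<close>
inductive dimension_tree :: "nat set \<Rightarrow> nat set set \<Rightarrow> bool" where
  leaf: "dimension_tree {k} {{k}}"
| node: "dimension_tree (\<alpha> \<union> \<beta>) (insert (\<alpha> \<union> \<beta>) (S \<union> S'))"
    if "dimension_tree \<alpha> S" and "dimension_tree \<beta> S'" and "\<alpha> \<inter> \<beta> = {}"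

text \<open>
  Rows and columns of a matricization are numbered from 0 in mixed radix (colexicographic
  order): \<open>mode_index n \<alpha> i k\<close> is the index, in \<open>{1..n k}\<close>, of mode \<open>k \<in> \<alpha>\<close> in the \<open>i\<close>-th
  multi-index over the modes in \<open>\<alpha>\<close>, for \<open>i < (\<Prod>k\<in>\<alpha>. n k)\<close>.
\<close>
definition mode_index :: "(nat \<Rightarrow> nat) \<Rightarrow> nat set \<Rightarrow> nat \<Rightarrow> nat \<Rightarrow> nat" where
  "mode_index n \<alpha> i k = (i div (\<Prod>l\<in>{l\<in>\<alpha>. l < k}. n l)) mod n k + 1"

definition matricization ::
  "nat \<Rightarrow> (nat \<Rightarrow> nat) \<Rightarrow> ((nat \<Rightarrow> nat) \<Rightarrow> 'i::finite) \<Rightarrow> nat set \<Rightarrow> real ^ 'i \<Rightarrow> real Matrix.mat" where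
  "matricization d n pos \<alpha> f =
     Matrix.mat (\<Prod>k\<in>\<alpha>. n k) (\<Prod>k\<in>{1..d} - \<alpha>. n k)
       (\<lambda>(i, j). f $ pos (\<lambda>k\<in>{1..d}.
          if k \<in> \<alpha> then mode_index n \<alpha> i k else mode_index n ({1..d} - \<alpha>) j k))"

definition matricization_rank ::
  "nat \<Rightarrow> (nat \<Rightarrow> nat) \<Rightarrow> ((nat \<Rightarrow> nat) \<Rightarrow> 'i::finite) \<Rightarrow> nat set \<Rightarrow> real ^ 'i \<Rightarrow> nat" where
  "matricization_rank d n pos \<alpha> f = vec_space.rank (\<Prod>k\<in>\<alpha>. n k) (matricization d n pos \<alpha> f)"

definition HT_closed ::
  "nat \<Rightarrow> (nat \<Rightarrow> nat) \<Rightarrow> ((nat \<Rightarrow> nat) \<Rightarrow> 'i::finite) \<Rightarrow> nat set set \<Rightarrow> (nat set \<Rightarrow> nat)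
   \<Rightarrow> (real ^ 'i) set" where
  "HT_closed d n pos S r = {f. \<forall>\<alpha>\<in>S. matricization_rank d n pos \<alpha> f \<le> r \<alpha>}"

definition best_approximation :: "(real ^ 'i::finite) set \<Rightarrow> real ^ 'i \<Rightarrow> real ^ 'i \<Rightarrow> bool" where
  "best_approximation H f h \<longleftrightarrow> is_arg_min (\<lambda>g. norm (f - g)) (\<lambda>g. g \<in> H) h"

text \<open>
  The constant \<open>C\<close> may depend on the set \<open>H\<close> but not on \<open>f\<close>; \<open>C = 1\<close> gives the optimal
  truncations, and \<open>C = sqrt (2 * d - 3)\<close> covers the high-order SVD truncation.
\<close>
definition quasi_optimal_truncation ::
  "(real ^ 'i::finite) set \<Rightarrow> (real ^ 'i \<Rightarrow> real ^ 'i) \<Rightarrow> bool" where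
  "quasi_optimal_truncation H \<T> \<longleftrightarrow>
     (\<forall>f. \<T> f \<in> H) \<and>
     (\<exists>C. \<forall>f. \<exists>h. best_approximation H f h \<and> norm (f - \<T> f) \<le> C * norm (f - h))"

primrec rank_adaptive_euler ::
  "(real ^ 'i \<Rightarrow> real ^ 'i) \<Rightarrow> ((nat set \<Rightarrow> nat) \<Rightarrow> real ^ 'i \<Rightarrow> real ^ 'i)
   \<Rightarrow> (nat \<Rightarrow> nat set \<Rightarrow> nat) \<Rightarrow> (nat \<Rightarrow> nat set \<Rightarrow> nat) \<Rightarrow> real \<Rightarrow> real ^ 'i::finite
   \<Rightarrow> nat \<Rightarrow> real ^ 'i" where
  "rank_adaptive_euler G \<T> r s h f0 0 = f0"
| "rank_adaptive_euler G \<T> r s h f0 (Suc k) =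
     (let f = rank_adaptive_euler G \<T> r s h f0 k
      in \<T> (r k) (f + h *\<^sub>R \<T> (s k) (G f)))"

end

theory Submission
  imports Defs
begin

text \<open>
  The argument is the classical convergence proof for the explicit Euler method, with the two
  truncations treated as perturbations of each step. As \<open>G\<close> is Lipschitz and the exact
  solution stays in a compact set, the solution itself is Lipschitz, so that its velocity varies
  by \<open>O(h)\<close> over a step of length \<open>h\<close> and one exact Euler step misses it by \<open>O(h\<^sup>2)\<close>
  (\<open>euler_consistency\<close>). Truncating the velocity costs \<open>h * (M1 * h)\<close> and truncating the
  result costs \<open>M2 * h\<^sup>2\<close>, so all three defects have the same order \<open>h\<^sup>2\<close>. The error therefore
  satisfies \<open>e (k + 1) \<le> (1 + L * h) * e k + K * h\<^sup>2\<close>, and since only \<open>N = T / h\<close> steps are made,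
  the defects accumulate to at most \<open>T * K * exp (L * T) * h\<close> (\<open>discrete_gronwall\<close>).

  The truncations are controlled at the iterates alone, not at the exact solution. Each step of the
  method is therefore compared with an untruncated Euler step from the same iterate, and it is the
  Lipschitz bound on \<open>G\<close> that carries errors from one step to the next (\<open>perturbed_euler_step\<close>).
\<close>

lemma discrete_gronwall:
  fixes e :: "nat \<Rightarrow> real"
  assumes "e 0 \<le> 0" and "a \<ge> 1" and "b \<ge> 0"
    and step: "\<And>k. k < n \<Longrightarrow> e (Suc k) \<le> a * e k + b"
  shows "e n \<le> real n * b * a ^ n"
proof -
  have "e k \<le> real k * b * a ^ k" if "k \<le> n" for k
    using that
  proof (induction k)
    case 0
    then show ?case using assms by simp
  next
    case (Suc k)
    have "1 \<le> a ^ Suc k" using \<open>a \<ge> 1\<close> by (rule one_le_power)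
    then have "b \<le> b * a ^ Suc k" using mult_left_mono[OF _ \<open>b \<ge> 0\<close>] by fastforce
    moreover have "a * e k \<le> a * (real k * b * a ^ k)"
      using Suc \<open>a \<ge> 1\<close> by (intro mult_left_mono) auto
    ultimately have "e (Suc k) \<le> a * (real k * b * a ^ k) + b * a ^ Suc k"
      using step[of k] Suc.prems by linarith
    then show ?case by (simp add: algebra_simps)
  qed
  then show ?thesis by simp
qed

text \<open>
  Compactness of the time interval bounds the velocity along the trajectory by some \<open>B\<close>, so that
  it changes by at most \<open>L * B * h\<close> over a step of length \<open>h\<close>. Since \<open>f\<close> may fail to
  have a second derivative, the mean value inequality takes the place of a Taylor expansion.
\<close>
lemma euler_consistency:
  fixes f :: "real \<Rightarrow> 'a::real_normed_vector" and G :: "'a \<Rightarrow> 'a"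
  assumes lip: "L-lipschitz_on UNIV G"
    and sol: "\<And>t. t \<in> {0..T} \<Longrightarrow> (f has_vector_derivative G (f t)) (at t within {0..T})"
  obtains C where "C \<ge> 0"
    and "\<And>t h. 0 \<le> t \<Longrightarrow> 0 \<le> h \<Longrightarrow> t + h \<le> T \<Longrightarrow>
           norm (f (t + h) - f t - h *\<^sub>R G (f t)) \<le> C * h\<^sup>2"
proof -
  have L: "L \<ge> 0" using lip by (rule lipschitz_on_nonneg)
  have "continuous_on {0..T} f"
    using sol by (meson continuous_on_eq_continuous_within has_vector_derivative_continuous)
  then have "continuous_on {0..T} (\<lambda>t. G (f t))"
    using lipschitz_on_continuous_on[OF lip] by (auto intro: continuous_on_compose2)
  then have "bounded ((\<lambda>t. G (f t)) ` {0..T})"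
    by (intro compact_imp_bounded compact_continuous_image) auto
  then obtain B where "B > 0" and B: "\<And>t. t \<in> {0..T} \<Longrightarrow> norm (G (f t)) \<le> B"
    by (auto simp: bounded_pos)
  have consistent: "norm (f (t + h) - f t - h *\<^sub>R G (f t)) \<le> (L * B) * h\<^sup>2"
    if t: "0 \<le> t" and h: "0 \<le> h" and th: "t + h \<le> T" for t h
  proof -
    have sub: "{t..t + h} \<subseteq> {0..T}" using t th by auto
    have der: "(f has_vector_derivative G (f x)) (at x within {t..t + h})"
      if "x \<in> {t..t + h}" for x
      using sol[of x] sub that by (meson has_vector_derivative_within_subset subsetD)
    have near: "norm (f x - f t) \<le> B * h" if x: "x \<in> {t..t + h}" for x
    proof -
      have "norm (f x - f t) \<le> B * norm (x - t)"
      proof (rule differentiable_bound[of "{t..t + h}" f "\<lambda>u v. v *\<^sub>R G (f u)"])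
        fix u assume u: "u \<in> {t..t + h}"
        show "(f has_derivative (\<lambda>v. v *\<^sub>R G (f u))) (at u within {t..t + h})"
          using der[OF u] by (simp add: has_vector_derivative_def)
        have "norm (v *\<^sub>R G (f u)) \<le> B * norm v" for v
          using B[of u] u sub mult_left_mono[of "norm (G (f u))" B "\<bar>v\<bar>"]
          by (auto simp: mult.commute)
        then show "onorm (\<lambda>v. v *\<^sub>R G (f u)) \<le> B"
          by (intro onorm_le) auto
      qed (use x h in auto)
      also have "\<dots> \<le> B * h" using x \<open>B > 0\<close> by (intro mult_left_mono) auto
      finally show ?thesis .
    qed
    have "norm (f (t + h) - f t - (t + h - t) *\<^sub>R G (f t)) \<le> norm (t + h - t) * (L * (B * h))"
    proof (rule vector_differentiable_bound_linearization[of "{t..t + h}" f "\<lambda>x. G (f x)"])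
      fix x assume x: "x \<in> {t..t + h}"
      show "(f has_vector_derivative G (f x)) (at x within {t..t + h})" by (rule der[OF x])
      have "norm (G (f x) - G (f t)) \<le> L * norm (f x - f t)"
        using lipschitz_onD[OF lip] by (simp add: dist_norm)
      also have "\<dots> \<le> L * (B * h)" using near[OF x] L by (rule mult_left_mono)
      finally show "norm (G (f x) - G (f t)) \<le> L * (B * h)" .
    qed (use h in \<open>auto simp: closed_segment_eq_real_ivl\<close>)
    then show ?thesis using h by (simp add: power2_eq_square mult_ac)
  qed
  show ?thesis
    by (rule that[of "L * B"]) (use L \<open>B > 0\<close> consistent in auto)
qed

text \<open>
  One step of any perturbed Euler scheme: \<open>V\<close> is the velocity actually used in place of \<open>G y\<close>, and
  \<open>z\<close> the result actually stored in place of \<open>y + h *\<^sub>R V\<close>. Only the comparison of \<open>G x\<close> with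
  \<open>G y\<close> amplifies the error \<open>x - y\<close> of the previous step.
\<close>
lemma perturbed_euler_step:
  fixes x y z x' V :: "'a::real_normed_vector"
  assumes lip: "L-lipschitz_on UNIV G" and h: "h \<ge> 0"
    and x': "norm (x' - x - h *\<^sub>R G x) \<le> C * h\<^sup>2"
    and V: "norm (G y - V) \<le> M1 * h"
    and z: "norm (y + h *\<^sub>R V - z) \<le> M2 * h\<^sup>2"
  shows "norm (x' - z) \<le> (1 + L * h) * norm (x - y) + (C + M1 + M2) * h\<^sup>2"
proof -
  have "x' - z = (x' - x - h *\<^sub>R G x) + (x - y) + h *\<^sub>R (G x - G y) + h *\<^sub>R (G y - V)
      + (y + h *\<^sub>R V - z)"
    by (simp add: algebra_simps)
  then have "norm (x' - z) \<le> norm (x' - x - h *\<^sub>R G x) + norm (x - y) + norm (h *\<^sub>R (G x - G y))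
      + norm (h *\<^sub>R (G y - V)) + norm (y + h *\<^sub>R V - z)"
    by (metis (no_types, lifting) norm_triangle_mono order_refl)
  moreover have "norm (h *\<^sub>R (G x - G y)) \<le> h * (L * norm (x - y))"
    using lipschitz_onD[OF lip, of x y] h by (auto simp: dist_norm intro: mult_left_mono)
  moreover have "norm (h *\<^sub>R (G y - V)) \<le> h * (M1 * h)"
    using V h by (auto intro: mult_left_mono)
  ultimately show ?thesis
    using x' z by (simp add: algebra_simps power2_eq_square)
qed

theorem mainTheorem3:
  fixes d :: nat and n :: "nat \<Rightarrow> nat" and pos :: "(nat \<Rightarrow> nat) \<Rightarrow> 'i::finite"
    and S :: "nat set set"
    and \<T> :: "(nat set \<Rightarrow> nat) \<Rightarrow> real ^ 'i \<Rightarrow> real ^ 'i"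
    and G :: "real ^ 'i \<Rightarrow> real ^ 'i"
    and f :: "real \<Rightarrow> real ^ 'i" and f0 :: "real ^ 'i" and T :: real
    and r s :: "nat \<Rightarrow> nat \<Rightarrow> nat set \<Rightarrow> nat"
    and fk :: "nat \<Rightarrow> nat \<Rightarrow> real ^ 'i"
    and \<Delta> :: "nat \<Rightarrow> real"
    and M1 M2 :: real
  defines "\<Delta> \<equiv> \<lambda>N. T / real N"
    and "fk \<equiv> \<lambda>N. rank_adaptive_euler G \<T> (r N) (s N) (\<Delta> N) f0"
  assumes "d \<ge> 2"
    and "tensor_indexing d n pos"
    and "dimension_tree {1..d} S"
    and "\<And>\<rho>. quasi_optimal_truncation (HT_closed d n pos S \<rho>) (\<T> \<rho>)"
    and "\<exists>L. L-lipschitz_on UNIV G"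
    and "T > 0"
    and "\<And>t. t \<in> {0..T} \<Longrightarrow> (f has_vector_derivative G (f t)) (at t within {0..T})"
    and "f 0 = f0"
    and "\<And>N k. k < N \<Longrightarrow>
           norm (G (fk N k) - \<T> (s N k) (G (fk N k))) \<le> M1 * \<Delta> N"
    and "\<And>N k. k < N \<Longrightarrow>
           norm (fk N k + \<Delta> N *\<^sub>R \<T> (s N k) (G (fk N k))
                 - \<T> (r N k) (fk N k + \<Delta> N *\<^sub>R \<T> (s N k) (G (fk N k))))
             \<le> M2 * (\<Delta> N)\<^sup>2"
  shows "\<exists>Q. \<exists>\<delta>>0. \<forall>N\<ge>1. \<Delta> N < \<delta> \<longrightarrow> norm (f T - fk N N) \<le> Q * \<Delta> N"
proof -
  obtain L where lip: "L-lipschitz_on UNIV G" using assms(7) by blast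
  have L: "L \<ge> 0" using lip by (rule lipschitz_on_nonneg)
  obtain C where "C \<ge> 0"
    and C: "\<And>t h. 0 \<le> t \<Longrightarrow> 0 \<le> h \<Longrightarrow> t + h \<le> T \<Longrightarrow>
           norm (f (t + h) - f t - h *\<^sub>R G (f t)) \<le> C * h\<^sup>2"
    using euler_consistency[OF lip assms(9)] by blast
  define K where "K = C + M1 + M2"
  have "M1 \<ge> 0" "M2 \<ge> 0"
    using order_trans[OF norm_ge_zero assms(11)[of 0 1]]
      order_trans[OF norm_ge_zero assms(12)[of 0 1]] \<open>T > 0\<close>
    by (simp_all add: \<Delta>_def zero_le_mult_iff)
  with \<open>C \<ge> 0\<close> have K: "K \<ge> 0" by (simp add: K_def)
  have "norm (f T - fk N N) \<le> (T * K * exp (L * T)) * \<Delta> N" if "N \<ge> 1" for N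
  proof -
    define h where "h = \<Delta> N"
    have h: "h > 0" and Nh: "real N * h = T"
      using \<open>N \<ge> 1\<close> \<open>T > 0\<close> by (auto simp: h_def \<Delta>_def)
    define e where "e k = norm (f (real k * h) - fk N k)" for k
    have "e N \<le> real N * (K * h\<^sup>2) * (1 + L * h) ^ N"
    proof (rule discrete_gronwall)
      show "e 0 \<le> 0" using assms(10) by (simp add: e_def fk_def)
      fix k assume k: "k < N"
      have "real (Suc k) * h \<le> real N * h" using k h by (intro mult_right_mono) auto
      then have "real k * h + h \<le> T" using Nh by (simp add: algebra_simps)
      then have consistency: "norm (f (real k * h + h) - f (real k * h) - h *\<^sub>R G (f (real k * h)))
          \<le> C * h\<^sup>2"
        using h by (intro C) auto
      have "fk N (Suc k) = \<T> (r N k) (fk N k + h *\<^sub>R \<T> (s N k) (G (fk N k)))"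
        by (simp add: fk_def h_def Let_def)
      then have "norm (f (real k * h + h) - fk N (Suc k))
          \<le> (1 + L * h) * norm (f (real k * h) - fk N k) + K * h\<^sup>2"
        unfolding K_def
        using perturbed_euler_step[OF lip _ consistency assms(11)[OF k, folded h_def]
            assms(12)[OF k, folded h_def]] h by simp
      then show "e (Suc k) \<le> (1 + L * h) * e k + K * h\<^sup>2"
        by (simp add: e_def algebra_simps)
    qed (use L K h in auto)
    also have "\<dots> \<le> real N * (K * h\<^sup>2) * exp (L * T)"
    proof (rule mult_left_mono)
      have "(1 + L * h) ^ N \<le> exp (L * h) ^ N"
        using L h by (intro power_mono exp_ge_add_one_self) auto
      also have "\<dots> = exp (L * T)"
        by (simp add: exp_of_nat_mult[symmetric] Nh[symmetric] mult_ac)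
      finally show "(1 + L * h) ^ N \<le> exp (L * T)" .
    qed (use K in auto)
    also have "\<dots> = (T * K * exp (L * T)) * h"
      by (simp add: Nh[symmetric] power2_eq_square mult_ac)
    finally show ?thesis by (simp add: e_def Nh h_def[symmetric])
  qed
  then show ?thesis by (intro exI[of _ "T * K * exp (L * T)"] exI[of _ 1]) auto
qed

end
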